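(* Let $G$ be a cubic graph. Then $$\gamma(G)\leq \left(\frac{7}{6}-\frac{1}{204}\right)\gamma_e(G).$$
   Context: All graphs are finite, simple, and undirected. A graph is cubic if it is $3$-regular, that is, every vertex has exactly $3$ neighbors. A set $D\subseteq V(G)$ is a dominating set in $G$ if every vertex in $V(G)\setminus D$ has a neighbor in $D$; the domination number $\gamma(G)$ is the minimum cardinality of a dominating set in $G$. A matching in $G$ is a set of pairwise disjoint edges of $G$; it is maximal if it is maximal with respect to inclusion among matchings in $G$ (equivalently, the set of vertices not incident with any edge of the matching is independent). The edge domination number $\gamma_e(G)$ is the minimum size (number of edges) of a maximal matching in $G$. *)

theory Defs
  imports Complex_Main
begin

locale simple_graph =
  fixes V :: "'a set" and E :: "'a set set"
  assumes finite_verts: "finite V"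
    and edges: "\<And>e. e \<in> E \<Longrightarrow> e \<subseteq> V \<and> card e = 2"

definition neighbors :: "'a set set \<Rightarrow> 'a \<Rightarrow> 'a set" where
  "neighbors E v = {u. {u, v} \<in> E}"

locale cubic_graph = simple_graph V E for V :: "'a set" and E :: "'a set set" +
  assumes cubic: "\<And>v. v \<in> V \<Longrightarrow> card (neighbors E v) = 3"

definition dominating_set :: "'a set \<Rightarrow> 'a set set \<Rightarrow> 'a set \<Rightarrow> bool" where
  "dominating_set V E D \<longleftrightarrow> D \<subseteq> V \<and> (\<forall>v \<in> V - D. neighbors E v \<inter> D \<noteq> {})"

definition domination_number :: "'a set \<Rightarrow> 'a set set \<Rightarrow> nat" where
  "domination_number V E = Min (card ` {D. dominating_set V E D})"

definition graph_matching :: "'a set set \<Rightarrow> 'a set set \<Rightarrow> bool" where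
  "graph_matching E M \<longleftrightarrow> M \<subseteq> E \<and> (\<forall>e \<in> M. \<forall>f \<in> M. e \<noteq> f \<longrightarrow> e \<inter> f = {})"

definition maximal_matching :: "'a set set \<Rightarrow> 'a set set \<Rightarrow> bool" where
  "maximal_matching E M \<longleftrightarrow>
     graph_matching E M \<and> (\<forall>N. graph_matching E N \<and> M \<subseteq> N \<longrightarrow> N = M)"

definition edge_domination_number :: "'a set set \<Rightarrow> nat" where
  "edge_domination_number E = Min (card ` {M. maximal_matching E M})"

text \<open>Both minima range over finite nonempty sets, so \<open>Min\<close> is meaningful.\<close>

context simple_graph
begin

lemma finite_edges: "finite E"
proof (rule finite_subset)
  show "E \<subseteq> Pow V" using edges by blast
qed (simp add: finite_verts)

lemma finite_dominating_sets: "finite {D. dominating_set V E D}"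
  by (rule finite_subset[of _ "Pow V"]) (auto simp: dominating_set_def finite_verts)

lemma dominating_sets_nonempty: "{D. dominating_set V E D} \<noteq> {}"
  by (auto simp: dominating_set_def intro: exI[of _ V])

lemma finite_maximal_matchings: "finite {M. maximal_matching E M}"
  by (rule finite_subset[of _ "Pow E"])
    (auto simp: maximal_matching_def graph_matching_def finite_edges)

lemma maximal_matchings_nonempty: "{M. maximal_matching E M} \<noteq> {}"
proof -
  have fin: "finite {M. graph_matching E M}"
    by (rule finite_subset[of _ "Pow E"]) (auto simp: graph_matching_def finite_edges)
  have "{} \<in> {M. graph_matching E M}"
    by (simp add: graph_matching_def)
  then obtain M where "M \<in> {M. graph_matching E M}"
      "\<And>N. N \<in> {M. graph_matching E M} \<Longrightarrow> M \<subseteq> N \<Longrightarrow> M = N"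
    using finite_has_maximal[OF fin] by blast
  then show ?thesis
    unfolding maximal_matching_def by blast
qed

end

end

theory Submission
  imports Defs
begin

text \<open>Let \<open>M\<close> be a minimum maximal matching, so that the uncovered vertices form an independent set.
  Take one endpoint of every edge of \<open>M\<close>, together with the uncovered vertices this leaves
  undominated. A choice of endpoints is a truth assignment to variables indexed by \<open>M\<close>. An uncovered
  vertex whose neighbours lie on three distinct edges of \<open>M\<close> is a 3-clause, undominated iff the
  clause is falsified; other uncovered vertices are always dominated. Every literal occurs in at
  most two clauses, so there are at most \<open>4 |M| / 3\<close> clauses and a random assignment falsifies at
  most \<open>|M| / 6\<close> of them on average.

  To save a further \<open>|M| / 144\<close>, consider the discrete derivative of the number of falsified clauses
  in the direction of a variable \<open>h\<close>. It is integral of degree at most two; so unless \<open>h\<close> is inert,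
  i.e. its derivative vanishes, the derivative is nonzero on a quarter of all assignments, and
  setting \<open>h\<close> optimally instead of at random saves \<open>1 / 8\<close>. These savings add up over variables that
  pairwise share no clause, and a ninth of the non-inert variables can be so chosen. A variable
  occurring at most three times saves \<open>1 / 24\<close> in the average. Finally, an inert variable \<open>h\<close> that
  occurs four times lies in two clauses \<open>{h, a, b}\<close> and \<open>{\<not>h, a, b}\<close>; the variables of \<open>a\<close> and
  \<open>b\<close> are not inert, and each of \<open>a\<close> and \<open>b\<close> determines \<open>h\<close>, so there are no more variables of
  this kind than non-inert ones.\<close>

subsection \<open>Real functions of truth assignments\<close>

text \<open>An assignment is encoded as its set of true variables. The derivative ignores the value
  of \<open>h\<close> itself, so deriving twice along \<open>h\<close> gives zero.\<close>

definition discrete_deriv :: "'h \<Rightarrow> ('h set \<Rightarrow> real) \<Rightarrow> 'h set \<Rightarrow> real" where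
  "discrete_deriv h f s = f (insert h s) - f (s - {h})"

text \<open>This is polynomial degree without polynomials. The base case asks for constancy on all
  sets, infinite ones included; on an infinite type this is stronger than the vanishing of all
  derivatives.\<close>

primrec deg_le :: "nat \<Rightarrow> ('h set \<Rightarrow> real) \<Rightarrow> bool" where
  "deg_le 0 f \<longleftrightarrow> (\<forall>s t. f s = f t)"
| "deg_le (Suc d) f \<longleftrightarrow> (\<forall>h. deg_le d (discrete_deriv h f))"

lemma discrete_deriv_sum:
  "discrete_deriv h (\<lambda>s. \<Sum>w\<in>B. f w s) s = (\<Sum>w\<in>B. discrete_deriv h (f w) s)"
  by (simp add: discrete_deriv_def sum_subtractf)

lemma deg_le_0_iff: "deg_le 0 f \<longleftrightarrow> (\<exists>c. f = (\<lambda>_. c))"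
proof
  assume "deg_le 0 f"
  then have "f s = f {}" for s by simp
  then have "f = (\<lambda>_. f {})" by (rule ext)
  then show "\<exists>c. f = (\<lambda>_. c)" ..
qed auto

lemma deg_le_const: "deg_le d (\<lambda>_. c)"
proof (induction d arbitrary: c)
  case (Suc d)
  have "discrete_deriv h (\<lambda>_. c) = (\<lambda>_. 0)" for h :: 'a
    by (simp add: discrete_deriv_def fun_eq_iff)
  with Suc show ?case by simp
qed simp

lemma deg_le_add: "deg_le d f \<Longrightarrow> deg_le d g \<Longrightarrow> deg_le d (\<lambda>s. f s + g s)"
proof (induction d arbitrary: f g)
  case 0
  then show ?case by (auto simp only: deg_le_0_iff)
next
  case (Suc d)
  have "discrete_deriv h (\<lambda>s. f s + g s) = (\<lambda>s. discrete_deriv h f s + discrete_deriv h g s)" for h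
    by (simp add: discrete_deriv_def fun_eq_iff)
  moreover have "deg_le d (discrete_deriv h f)" "deg_le d (discrete_deriv h g)" for h
    using Suc.prems by simp_all
  ultimately show ?case using Suc.IH by (simp only: deg_le.simps(2)) blast
qed

lemma deg_le_uminus: "deg_le d f \<Longrightarrow> deg_le d (\<lambda>s. - f s)"
proof (induction d arbitrary: f)
  case 0
  then show ?case by (auto simp only: deg_le_0_iff)
next
  case (Suc d)
  have "discrete_deriv h (\<lambda>s. - f s) = (\<lambda>s. - discrete_deriv h f s)" for h
    by (simp add: discrete_deriv_def fun_eq_iff)
  moreover have "deg_le d (discrete_deriv h f)" for h
    using Suc.prems by simp
  ultimately show ?case using Suc.IH by (simp only: deg_le.simps(2)) blast
qed

lemma deg_le_sum: "(\<And>i. i \<in> A \<Longrightarrow> deg_le d (f i)) \<Longrightarrow> deg_le d (\<lambda>s. \<Sum>i\<in>A. f i s)"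
  by (induction A rule: infinite_finite_induct) (simp_all add: deg_le_const deg_le_add)

text \<open>Fixing the value of \<open>x\<close> commutes with derivatives in other directions and
  makes the one along \<open>x\<close> vanish.\<close>

lemma deg_le_restrict:
  assumes "deg_le d f"
  shows "deg_le d (\<lambda>s. f (insert x s))" "deg_le d (\<lambda>s. f (s - {x}))"
  using assms
proof (induction d arbitrary: f)
  case 0
  {
    case 1 then show ?case by (auto simp only: deg_le_0_iff)
  next
    case 2 then show ?case by (auto simp only: deg_le_0_iff)
  }
next
  case (Suc d)
  have *: "discrete_deriv h (\<lambda>s. f (insert x s)) =
    (if h = x then (\<lambda>_. 0) else (\<lambda>s. discrete_deriv h f (insert x s)))"
    "discrete_deriv h (\<lambda>s. f (s - {x})) =
    (if h = x then (\<lambda>_. 0) else (\<lambda>s. discrete_deriv h f (s - {x})))" for h f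
    by (auto simp: discrete_deriv_def fun_eq_iff insert_commute insert_Diff_if
        Diff_insert[symmetric])
  {
    case 1
    then have "deg_le d (discrete_deriv h f)" for h by simp
    then have "deg_le d (\<lambda>s. discrete_deriv h f (insert x s))" for h
      by (rule Suc.IH(1))
    then show ?case
      by (simp only: deg_le.simps(2) * deg_le_const split: if_split) simp
  next
    case 2
    then have "deg_le d (discrete_deriv h f)" for h by simp
    then have "deg_le d (\<lambda>s. discrete_deriv h f (s - {x}))" for h
      by (rule Suc.IH(2))
    then show ?case
      by (simp only: deg_le.simps(2) * deg_le_const split: if_split) simp
  }
qed

text \<open>Away from \<open>k\<close> the indicator of the literal factors out of the derivative;
  along \<open>k\<close> only a restriction of \<open>f\<close> remains, up to sign.\<close>

lemma deg_le_mult_literal: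
  "deg_le d f \<Longrightarrow> deg_le (Suc d) (\<lambda>s. of_bool ((k \<in> s) = b) * f s)"
proof (induction d arbitrary: f)
  case 0
  then obtain c where "f = (\<lambda>_. c)"
    by (auto simp only: deg_le_0_iff)
  then have "discrete_deriv h (\<lambda>s. of_bool ((k \<in> s) = b) * f s) =
    (\<lambda>_. if h = k then (if b then c else - c) else 0)" for h
    by (auto simp: discrete_deriv_def fun_eq_iff)
  then show ?case by (simp add: deg_le_const)
next
  case (Suc d)
  have *: "discrete_deriv h (\<lambda>s. of_bool ((k \<in> s) = b) * f s) =
    (if h \<noteq> k then (\<lambda>s. of_bool ((k \<in> s) = b) * discrete_deriv h f s)
     else if b then (\<lambda>s. f (insert k s)) else (\<lambda>s. - f (s - {k})))" for h
    by (auto simp: discrete_deriv_def fun_eq_iff)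
  have "deg_le (Suc d) (discrete_deriv h (\<lambda>s. of_bool ((k \<in> s) = b) * f s))" for h
  proof (cases "h = k")
    case True
    then show ?thesis
      using deg_le_restrict[OF Suc.prems, of k] deg_le_uminus
      by (auto simp only: * if_False simp_thms split: if_split)
  next
    case False
    have "deg_le d (discrete_deriv h f)" using Suc.prems by simp
    from Suc.IH[OF this] show ?thesis
      using False by (simp only: * if_True simp_thms)
  qed
  then show ?case
    using deg_le.simps(2) by blast
qed

section \<open>Counting and averaging over all subsets\<close>

lemma sum_Pow_insert:
  assumes "finite H" "x \<notin> H"
  shows "(\<Sum>s\<in>Pow (insert x H). f s) = (\<Sum>s\<in>Pow H. f s) + (\<Sum>s\<in>Pow H. f (insert x s))"
proof -
  have "inj_on (insert x) (Pow H)"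
    using assms(2) by (auto simp: inj_on_def)
  then show ?thesis
    using assms
    by (subst Pow_insert, subst sum.union_disjoint) (auto simp: sum.reindex)
qed

text \<open>As \<open>s\<close> runs over \<open>Pow H\<close>, inserting \<open>x\<close> hits each
  subset containing \<open>x\<close> twice, and removing \<open>x\<close> hits each of the others
  twice.\<close>

lemma sum_Pow_split:
  fixes f :: "'h set \<Rightarrow> real"
  assumes "finite H" "x \<in> H"
  shows "2 * (\<Sum>s\<in>Pow H. f s) = (\<Sum>s\<in>Pow H. f (insert x s) + f (s - {x}))"
proof -
  obtain H' where H: "H = insert x H'" "x \<notin> H'" "finite H'"
    using assms by (metis finite_insert mk_disjoint_insert)
  have "f (s - {x}) = f s" if "s \<in> Pow H'" for s
    using that H(2) by (metis Diff_empty Diff_insert0 PowD subsetD)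
  then show ?thesis
    unfolding H(1) sum_Pow_insert[OF H(3,2)] by (simp add: sum.distrib)
qed

text \<open>The minimum distance of Reed--Muller codes.\<close>
lemma card_nonzero_deg_le:
  assumes "finite H" "deg_le d f" "t \<subseteq> H" "f t \<noteq> 0"
  shows "2 ^ card H \<le> 2 ^ d * (\<Sum>s\<in>Pow H. of_bool (f s \<noteq> 0) :: real)"
  using assms
proof (induction H arbitrary: f d t rule: finite_induct)
  case empty
  then show ?case by simp
next
  case (insert x H)
  let ?f0 = "\<lambda>s. f (s - {x})" and ?f1 = "\<lambda>s. f (insert x s)"
  let ?S = "\<lambda>f. \<Sum>s\<in>Pow H. of_bool (f s \<noteq> 0) :: real"
  have nonneg: "?S g \<ge> 0" for g :: "'a set \<Rightarrow> real"
    by (simp add: sum_nonneg)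
  have f0: "?f0 s = f s" if "s \<in> Pow H" for s
    using that insert.hyps by (metis Diff_empty Diff_insert0 PowD subsetD)
  have split: "(\<Sum>s\<in>Pow (insert x H). of_bool (f s \<noteq> 0) :: real) = ?S ?f0 + ?S ?f1"
    unfolding sum_Pow_insert[OF insert.hyps] using f0
    by (intro arg_cong2[where f = "(+)"] sum.cong) simp_all
  have deg: "deg_le d ?f0" "deg_le d ?f1"
    by (rule deg_le_restrict[OF insert.prems(1)])+
  show ?case
  proof (cases "(\<exists>s\<subseteq>H. ?f0 s \<noteq> 0) \<and> (\<exists>s\<subseteq>H. ?f1 s \<noteq> 0)")
    case True
    then obtain s s' where "s \<subseteq> H" "?f0 s \<noteq> 0" "s' \<subseteq> H" "?f1 s' \<noteq> 0" by auto
    then have "2 ^ card H \<le> 2 ^ d * ?S ?f0" "2 ^ card H \<le> 2 ^ d * ?S ?f1"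
      using insert.IH[OF deg(1)] insert.IH[OF deg(2)] by simp_all
    then show ?thesis
      using insert.hyps by (simp add: split distrib_left)
  next
    case False
    \<comment> \<open>One half vanishes identically, so on the other half \<open>f\<close> is, up to
      sign, its derivative along \<open>x\<close>, of degree one less. The factor gained in
      \<open>2 ^ d\<close> makes up for the halved cube.\<close>
    have t: "t - {x} \<subseteq> H" using insert.prems by auto
    have nz: "?f0 (t - {x}) \<noteq> 0 \<or> ?f1 (t - {x}) \<noteq> 0"
      using insert.prems(3) by (cases "x \<in> t") (auto simp: insert_absorb)
    moreover have "?f0 (t - {x}) = 0 \<or> ?f1 (t - {x}) = 0"
      using False t by blast
    ultimately have d: "discrete_deriv x f (t - {x}) \<noteq> 0"
      by (auto simp: discrete_deriv_def)
    obtain d' where d': "d = Suc d'"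
    proof (cases d)
      case 0
      then have "f (insert x (t - {x})) = f (t - {x} - {x})"
        using insert.prems(1) by (auto simp only: deg_le_0_iff)
      with d show ?thesis by (simp add: discrete_deriv_def)
    qed
    have "2 ^ card H \<le> 2 ^ d' * ?S (discrete_deriv x f)"
      using insert.IH[of d' "discrete_deriv x f" "t - {x}"] insert.prems(1) d t by (simp add: d')
    also have "?S (discrete_deriv x f) \<le> ?S ?f0 + ?S ?f1"
      unfolding sum.distrib[symmetric] by (intro sum_mono) (auto simp: discrete_deriv_def)
    finally show ?thesis
      using insert.hyps by (simp add: split d')
  qed
qed

text \<open>Replacing \<open>g\<close> by the minimum over the value at \<open>x\<close> lowers the average by half the mean
  of \<open>\<bar>discrete_deriv x g\<bar>\<close> and, by the vanishing mixed derivatives, keeps the derivatives in the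
  remaining directions.\<close>
lemma exists_le_mean_minus_derivs:
  fixes g :: "'h set \<Rightarrow> real"
  assumes "finite H" "finite W" "W \<subseteq> H"
    and "\<And>h k s. h \<in> W \<Longrightarrow> k \<in> W \<Longrightarrow> h \<noteq> k \<Longrightarrow> discrete_deriv k (discrete_deriv h g) s = 0"
  shows "\<exists>s\<subseteq>H. 2 ^ card H * g s
    \<le> (\<Sum>s\<in>Pow H. g s) - (\<Sum>h\<in>W. (\<Sum>s\<in>Pow H. \<bar>discrete_deriv h g s\<bar>) / 2)"
  using assms(2-)
proof (induction W arbitrary: g rule: finite_induct)
  case empty
  show ?case
  proof (rule ccontr)
    assume "\<not> ?thesis"
    then have "(\<Sum>s\<in>Pow H. g s) < 2 ^ card H * g s" if "s \<in> Pow H" for s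
      using that by auto
    then have "(\<Sum>t\<in>Pow H. (\<Sum>s\<in>Pow H. g s)) < (\<Sum>t\<in>Pow H. 2 ^ card H * g t)"
      using assms(1) by (intro sum_strict_mono) auto
    then show False
      using assms(1) by (simp add: card_Pow sum_distrib_left)
  qed
next
  case (insert x W)
  define g' where "g' = (\<lambda>s. min (g (insert x s)) (g (s - {x})))"
  have g': "2 * g' s = (g (insert x s) + g (s - {x})) - \<bar>discrete_deriv x g s\<bar>" for s
    by (auto simp: g'_def discrete_deriv_def)
  \<comment> \<open>The derivative along \<open>h\<close> does not depend on \<open>x\<close>, so
    changing \<open>h\<close> shifts both arguments of the minimum by the same amount.\<close>
  have deriv: "discrete_deriv h g' = discrete_deriv h g" if "h \<in> W" for h
  proof
    fix s
    have "h \<noteq> x" using that insert.hyps by auto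
    then have "discrete_deriv x (discrete_deriv h g) s = 0"
      "discrete_deriv h (discrete_deriv x g) s = 0"
      using insert.prems that by auto
    moreover have "discrete_deriv h g s = discrete_deriv h g (insert x s)
      \<or> discrete_deriv h g s = discrete_deriv h g (s - {x})"
      by (cases "x \<in> s") (auto simp: insert_absorb)
    moreover have "insert x s - {h} = insert x (s - {h})" "s - {x} - {h} = s - {h} - {x}"
      "insert h (s - {x}) = insert h s - {x}" "insert h (insert x s) = insert x (insert h s)"
      using \<open>h \<noteq> x\<close> by auto
    ultimately show "discrete_deriv h g' s = discrete_deriv h g s"
      by (auto simp: discrete_deriv_def g'_def min_def)
  qed
  have "\<exists>s\<subseteq>H. 2 ^ card H * g' s
    \<le> (\<Sum>s\<in>Pow H. g' s) - (\<Sum>h\<in>W. (\<Sum>s\<in>Pow H. \<bar>discrete_deriv h g' s\<bar>) / 2)"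
    by (rule insert.IH) (use insert.prems deriv in auto)
  then obtain s where s: "s \<subseteq> H" "2 ^ card H * g' s
    \<le> (\<Sum>s\<in>Pow H. g' s) - (\<Sum>h\<in>W. (\<Sum>s\<in>Pow H. \<bar>discrete_deriv h g s\<bar>) / 2)"
    using deriv by auto
  have "2 * (\<Sum>s\<in>Pow H. g' s)
    = 2 * (\<Sum>s\<in>Pow H. g s) - (\<Sum>s\<in>Pow H. \<bar>discrete_deriv x g s\<bar>)"
    using insert.prems assms(1)
    by (simp add: sum_distrib_left[of 2 g'] g' sum_subtractf sum_Pow_split[of H x g])
  with s(2) have "2 ^ card H * g' s \<le> (\<Sum>s\<in>Pow H. g s)
    - (\<Sum>h\<in>insert x W. (\<Sum>s\<in>Pow H. \<bar>discrete_deriv h g s\<bar>) / 2)"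
    using insert.hyps by simp
  \<comment> \<open>The better of the two values of \<open>x\<close> turns the assignment found for
    \<open>g'\<close> into one for \<open>g\<close>.\<close>
  moreover have "g' s = g (insert x s) \<or> g' s = g (s - {x})"
    by (auto simp: g'_def min_def)
  moreover have "insert x s \<subseteq> H" "s - {x} \<subseteq> H"
    using s(1) insert.prems by auto
  ultimately show ?case by metis
qed

section \<open>Independent sets in graphs of bounded degree\<close>

text \<open>Every element of \<open>X\<close> lies in or next to a maximal independent set, so
  closed neighbourhoods of size at most \<open>d + 1\<close> cover \<open>X\<close>.\<close>

lemma exists_large_independent_subset:
  fixes X :: "'h set"
  assumes "finite X" and sym: "\<And>x y. R x y \<Longrightarrow> R y x"
    and deg: "\<And>x. x \<in> X \<Longrightarrow> card {y \<in> X. y \<noteq> x \<and> R x y} \<le> d"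
  obtains W where "W \<subseteq> X" "\<And>x y. x \<in> W \<Longrightarrow> y \<in> W \<Longrightarrow> x \<noteq> y \<Longrightarrow> \<not> R x y"
    "card X \<le> (d + 1) * card W"
proof -
  let ?F = "{W. W \<subseteq> X \<and> (\<forall>x\<in>W. \<forall>y\<in>W. x \<noteq> y \<longrightarrow> \<not> R x y)}"
  have "finite ?F" "{} \<in> ?F" using assms(1) by auto
  then obtain W where W: "W \<in> ?F" and max: "\<And>W'. W' \<in> ?F \<Longrightarrow> W \<subseteq> W' \<Longrightarrow> W = W'"
    using finite_has_maximal[of ?F] by (metis (lifting) empty_iff)
  have "\<exists>w\<in>W. x = w \<or> R w x" if "x \<in> X" for x
  proof (rule ccontr)
    assume "\<not> ?thesis"
    then have "insert x W \<in> ?F" "x \<notin> W" using W that sym by auto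
    then show False using max[of "insert x W"] by auto
  qed
  then have "X \<subseteq> (\<Union>w\<in>W. insert w {y \<in> X. y \<noteq> w \<and> R w y})" by blast
  then have "card X \<le> card (\<Union>w\<in>W. insert w {y \<in> X. y \<noteq> w \<and> R w y})"
    using W assms(1) by (intro card_mono) (auto intro: finite_subset)
  also have "\<dots> \<le> (\<Sum>w\<in>W. card (insert w {y \<in> X. y \<noteq> w \<and> R w y}))"
    using W assms(1) by (intro card_UN_le) (auto intro: finite_subset)
  also have "\<dots> \<le> (\<Sum>w\<in>W. d + 1)"
    using W deg assms(1) by (intro sum_mono) (auto simp: card_insert_if)
  finally show thesis
    using that W by (auto simp: mult.commute)
qed

subsection \<open>Assignments falsifying few clauses\<close>

text \<open>A literal is a variable with its sign, \<open>True\<close> being positive. The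
  assignments falsifying a clause without complementary literals form a subcube, which is the view
  taken in the covering arguments.\<close>

definition falsified :: "('h \<times> bool) set \<Rightarrow> 'h set \<Rightarrow> bool" where
  "falsified C s \<longleftrightarrow> (\<forall>l\<in>C. (fst l \<in> s) \<noteq> snd l)"

definition neg_literal :: "'h \<times> bool \<Rightarrow> 'h \<times> bool" where
  "neg_literal l = (fst l, \<not> snd l)"

lemma neg_literal_simps [simp]:
  "fst (neg_literal l) = fst l" "snd (neg_literal l) = (\<not> snd l)"
  "neg_literal (neg_literal l) = l" "neg_literal l \<noteq> l" "l \<noteq> neg_literal l"
  "neg_literal l = neg_literal m \<longleftrightarrow> l = m"
  by (auto simp: neg_literal_def prod_eq_iff)

lemma fst_eq_literal_iff: "fst l = fst m \<longleftrightarrow> l = m \<or> l = neg_literal m"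
  by (auto simp: neg_literal_def prod_eq_iff)

lemma falsified_empty [simp]: "falsified {} s"
  by (simp add: falsified_def)

lemma falsified_insert [simp]:
  "falsified (insert l C) s \<longleftrightarrow> (fst l \<in> s) \<noteq> snd l \<and> falsified C s"
  by (auto simp: falsified_def)

lemma falsified_cong:
  "(\<And>h. h \<in> fst ` C \<Longrightarrow> h \<in> s \<longleftrightarrow> h \<in> t) \<Longrightarrow> falsified C s = falsified C t"
  by (auto simp: falsified_def)

lemma falsified_insert_var [simp]:
  "h \<notin> fst ` C \<Longrightarrow> falsified C (insert h s) \<longleftrightarrow> falsified C s"
  "h \<notin> fst ` C \<Longrightarrow> falsified C (s - {h}) \<longleftrightarrow> falsified C s"
  by (auto simp: falsified_def image_iff)

text \<open>Injectivity of \<open>fst\<close> excludes complementary literals, so making exactly the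
  negated variables true is consistent.\<close>

lemma exists_falsifying:
  assumes "fst ` C \<subseteq> H" "inj_on fst C"
  shows "\<exists>s\<subseteq>H. falsified C s"
proof (intro exI conjI)
  show "{h. (h, False) \<in> C} \<subseteq> H" using assms(1) by force
  show "falsified C {h. (h, False) \<in> C}"
    using assms(2) by (force simp: falsified_def inj_on_def)
qed

text \<open>Each literal on a new variable halves the subcube.\<close>

lemma sum_falsified:
  assumes "finite H" "finite C" "fst ` C \<subseteq> H" "inj_on fst C"
  shows "2 ^ card C * (\<Sum>s\<in>Pow H. of_bool (falsified C s) :: real) = 2 ^ card H"
  using assms(2-)
proof (induction C rule: finite_induct)
  case empty
  then show ?case using assms(1) by (simp add: card_Pow)
next
  case (insert l C)
  have l: "fst l \<in> H" "fst l \<notin> fst ` C"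
    using insert.prems insert.hyps by auto
  have "2 * (\<Sum>s\<in>Pow H. of_bool (falsified (insert l C) s) :: real)
      = (\<Sum>s\<in>Pow H. of_bool (falsified C s))"
    unfolding sum_Pow_split[OF assms(1) l(1)] using l(2) by (intro sum.cong) auto
  then have "2 ^ card (insert l C) * (\<Sum>s\<in>Pow H. of_bool (falsified (insert l C) s) :: real)
      = 2 ^ card C * (\<Sum>s\<in>Pow H. of_bool (falsified C s))"
    by (simp only: card_insert_disjoint[OF insert.hyps] power_Suc2 mult.assoc)
  then show ?case
    using insert.IH insert.prems by simp
qed

lemma deg_le_falsified:
  "finite C \<Longrightarrow> deg_le (card C) (\<lambda>s. of_bool (falsified C s))"
proof (induction C rule: finite_induct)
  case (insert l C)
  have "(\<lambda>s. of_bool (falsified (insert l C) s) :: real)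
      = (\<lambda>s. of_bool ((fst l \<in> s) = (\<not> snd l)) * of_bool (falsified C s))"
    by (auto simp: fun_eq_iff)
  then show ?case
    using deg_le_mult_literal[OF insert.IH] insert.hyps by (simp del: deg_le.simps)
qed (simp add: deg_le_const)

text \<open>A subcube of codimension two covered by two others either equals one of them or is cut
  in half by each, along complementary literals.\<close>
lemma falsified_cover_cases:
  assumes "inj_on fst P" "inj_on fst Q" "inj_on fst R"
    and "card P = 2" "card Q = 2" "card R = 2"
    and "fst ` P \<subseteq> H" "fst ` Q \<subseteq> H" "fst ` R \<subseteq> H"
    and cover: "\<And>s. s \<subseteq> H \<Longrightarrow> falsified P s \<Longrightarrow> falsified Q s \<or> falsified R s"
  shows "P = Q \<or> P = R \<or> (\<exists>z q r. Q = {z, q} \<and> R = {neg_literal z, r} \<and> z \<notin> P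
    \<and> neg_literal z \<notin> P \<and> q \<in> P \<and> r \<in> P)"
proof (cases "P = Q \<or> P = R")
  case False
  have fin: "finite P" "finite Q" "finite R"
    using assms(4-6) by (simp_all add: card_ge_0_finite)
  have sub: "\<exists>x. x \<in> X - P" if "X \<noteq> P" "card X = 2" for X
    using that card_subset_eq[OF fin(1), of X] assms(4) by (metis DiffI subsetI)
  \<comment> \<open>Otherwise some assignment falsifies \<open>P\<close> while making both
    \<open>q\<close> and \<open>r\<close> true, hence escapes both covering subcubes.\<close>
  have compl: "r = neg_literal q" if qr: "q \<in> Q - P" "r \<in> R - P" for q r
  proof (rule ccontr)
    assume ne: "r \<noteq> neg_literal q"
    let ?C = "insert (neg_literal q) (insert (neg_literal r) P)"
    have "inj_on fst ?C"
      using qr ne assms(1) unfolding inj_on_def by (auto simp: fst_eq_literal_iff)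
    moreover have "fst ` ?C \<subseteq> H"
      using qr assms(7-9) by auto
    ultimately obtain s where "s \<subseteq> H" "falsified ?C s"
      using exists_falsifying by metis
    then show False
      using cover[of s] qr by (auto simp: falsified_def)
  qed
  obtain z r' where z: "z \<in> Q - P" "r' \<in> R - P"
    using sub False assms(5,6) by metis
  then have r': "r' = neg_literal z" by (rule compl)
  \<comment> \<open>Every literal of \<open>Q\<close> outside \<open>P\<close> is complementary to
    every such literal of \<open>R\<close>, so each difference has just one element.\<close>
  have Q: "Q - P = {z}" using compl z r' by fastforce
  have R: "R - P = {neg_literal z}" using compl z r' by fastforce
  have "Q \<noteq> {z}" "R \<noteq> {neg_literal z}" using assms(5,6) by auto
  then obtain q r where q: "q \<in> Q" "q \<noteq> z" and r: "r \<in> R" "r \<noteq> neg_literal z"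
    using z r' by blast
  have "Q = {z, q}"
    using q z assms(5) fin by (intro card_subset_eq[symmetric]) auto
  moreover have "R = {neg_literal z, r}"
    using r r' z assms(6) fin by (intro card_subset_eq[symmetric]) auto
  moreover have "q \<in> P" "r \<in> P" "z \<notin> P" "neg_literal z \<notin> P"
    using Q R q r by auto
  ultimately show ?thesis by blast
qed auto

section \<open>Systems of 3-clauses and the derivative of the number of violations\<close>

text \<open>Here \<open>H\<close> will be the matching and \<open>A\<close> a set of uncovered
  vertices. Clauses are indexed because distinct vertices may give the same clause. The bound
  \<open>occ_le\<close> reflects that a covered vertex has two neighbours besides its
  partner.\<close>

locale clauses =
  fixes H :: "'h set" and A :: "'w set" and N :: "'w \<Rightarrow> ('h \<times> bool) set"
  assumes finite_H: "finite H" and finite_A: "finite A"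
    and vars: "\<And>w. w \<in> A \<Longrightarrow> fst ` N w \<subseteq> H"
    and card_N: "\<And>w. w \<in> A \<Longrightarrow> card (N w) = 3"
    and inj_N: "\<And>w. w \<in> A \<Longrightarrow> inj_on fst (N w)"
    and occ_le: "\<And>l. card {w \<in> A. l \<in> N w} \<le> 2"
begin

definition violations :: "'h set \<Rightarrow> real" where
  "violations s = (\<Sum>w\<in>A. of_bool (falsified (N w) s))"

text \<open>For clauses without complementary literals, these are the ones that hinge on
  \<open>l\<close>: under \<open>s\<close>, they are falsified exactly if \<open>l\<close>
  is.\<close>

definition critical :: "'h \<times> bool \<Rightarrow> 'h set \<Rightarrow> 'w set" where
  "critical l s = {w \<in> A. l \<in> N w \<and> falsified (N w - {l}) s}"

definition inert :: "'h \<Rightarrow> bool" where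
  "inert h \<longleftrightarrow> (\<forall>s\<subseteq>H. discrete_deriv h violations s = 0)"

lemma finite_N: "w \<in> A \<Longrightarrow> finite (N w)"
  using card_N by (metis card.infinite zero_neq_numeral)

lemma neg_notin_N: "w \<in> A \<Longrightarrow> l \<in> N w \<Longrightarrow> neg_literal l \<notin> N w"
  using inj_N[of w] by (force simp: inj_on_def)

lemma occ_three:
  assumes "l \<in> N x" "l \<in> N y" "l \<in> N z" "x \<in> A" "y \<in> A" "z \<in> A"
  shows "x = y \<or> x = z \<or> y = z"
proof (rule ccontr)
  assume "\<not> ?thesis"
  then have "card {x, y, z} = 3" by auto
  moreover have "card {x, y, z} \<le> card {w \<in> A. l \<in> N w}"
    using assms finite_A by (intro card_mono) auto
  ultimately show False using occ_le[of l] by simp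
qed

lemma discrete_deriv_falsified:
  assumes "w \<in> A"
  shows "discrete_deriv h (\<lambda>s. of_bool (falsified (N w) s)) s
    = of_bool (w \<in> critical (h, False) s) - of_bool (w \<in> critical (h, True) s)"
proof (cases "\<exists>b. (h, b) \<in> N w")
  case True
  then obtain b where b: "(h, b) \<in> N w" by blast
  then have b': "(h, \<not> b) \<notin> N w"
    using neg_notin_N[OF assms b] by (simp add: neg_literal_def)
  have "N w = insert (h, b) (N w - {(h, b)})" using b by auto
  then have *: "falsified (N w) t \<longleftrightarrow> (h \<in> t) \<noteq> b \<and> falsified (N w - {(h, b)}) t" for t
    using falsified_insert by (metis fst_conv snd_conv)
  have "h \<notin> fst ` (N w - {(h, b)})"
    using b' by auto (metis (full_types))+
  with b b' assms show ?thesis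
    unfolding discrete_deriv_def * by (cases b) (auto simp: critical_def)
next
  case False
  then have "h \<notin> fst ` N w" by auto
  with False show ?thesis by (auto simp: discrete_deriv_def critical_def)
qed

text \<open>Making \<open>h\<close> true falsifies the clauses that hinge on its negation and
  rescues those that hinge on \<open>h\<close>. In particular the derivative is integral.\<close>

lemma discrete_deriv_violations:
  "discrete_deriv h violations s
    = real (card (critical (h, False) s)) - real (card (critical (h, True) s))"
proof -
  have "discrete_deriv h violations s
      = (\<Sum>w\<in>A. of_bool (w \<in> critical (h, False) s) - of_bool (w \<in> critical (h, True) s))"
    unfolding violations_def discrete_deriv_sum
    by (intro sum.cong refl discrete_deriv_falsified)
  moreover have "(\<Sum>w\<in>A. of_bool (w \<in> critical l s)) = real (card (critical l s))" for l
    using finite_A by (simp add: critical_def Int_def)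
  ultimately show ?thesis by (simp add: sum_subtractf)
qed

lemma sum_violations: "(\<Sum>s\<in>Pow H. violations s) = 2 ^ card H * (card A / 8)"
proof -
  have "(\<Sum>s\<in>Pow H. violations s) = (\<Sum>w\<in>A. (\<Sum>s\<in>Pow H. of_bool (falsified (N w) s)))"
    unfolding violations_def by (rule sum.swap)
  also have "\<dots> = (\<Sum>w\<in>A. 2 ^ card H / 8)"
    using sum_falsified[OF finite_H finite_N vars inj_N] card_N
    by (intro sum.cong) (auto simp: field_simps)
  finally show ?thesis by simp
qed

lemma sum_abs_discrete_deriv_violations:
  assumes "\<not> inert h"
  shows "2 ^ card H / 4 \<le> (\<Sum>s\<in>Pow H. \<bar>discrete_deriv h violations s\<bar>)"
proof -
  obtain t where t: "t \<subseteq> H" "discrete_deriv h violations t \<noteq> 0"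
    using assms by (auto simp: inert_def)
  have "Suc 2 = 3" by simp
  then have "deg_le (Suc 2) violations"
    unfolding violations_def
    using deg_le_falsified[OF finite_N] card_N by (intro deg_le_sum) metis
  then have "deg_le 2 (discrete_deriv h violations)"
    by (simp only: deg_le.simps(2))
  from card_nonzero_deg_le[OF finite_H this t]
  have "2 ^ card H \<le> 2 ^ 2 * (\<Sum>s\<in>Pow H. of_bool (discrete_deriv h violations s \<noteq> 0) :: real)" .
  also have "(\<Sum>s\<in>Pow H. of_bool (discrete_deriv h violations s \<noteq> 0))
      \<le> (\<Sum>s\<in>Pow H. \<bar>discrete_deriv h violations s\<bar>)"
    by (intro sum_mono) (auto simp: discrete_deriv_violations)
  finally show ?thesis by simp
qed

text \<open>No clause contains two variables of \<open>W\<close>, so the mixed derivatives vanish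
  clause by clause. Each variable then saves half of the mean absolute derivative, which is at least
  \<open>1 / 4\<close>.\<close>

lemma exists_assignment_saving:
  assumes "W \<subseteq> H" and "\<And>h. h \<in> W \<Longrightarrow> \<not> inert h"
    and indep: "\<And>w h k. w \<in> A \<Longrightarrow> h \<in> W \<Longrightarrow> k \<in> W \<Longrightarrow> h \<noteq> k
      \<Longrightarrow> h \<in> fst ` N w \<Longrightarrow> k \<in> fst ` N w \<Longrightarrow> False"
  shows "\<exists>s\<subseteq>H. violations s \<le> card A / 8 - card W / 8"
proof -
  have "discrete_deriv k (discrete_deriv h violations) s = 0" if "h \<in> W" "k \<in> W" "h \<noteq> k" for h k s
  proof -
    have h: "discrete_deriv h violations
        = (\<lambda>s. \<Sum>w\<in>A. discrete_deriv h (\<lambda>s. of_bool (falsified (N w) s)) s)"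
      unfolding discrete_deriv_sum[symmetric] violations_def ..
    have "discrete_deriv k (discrete_deriv h (\<lambda>s. of_bool (falsified (N w) s))) s = 0"
      if "w \<in> A" for w
    proof -
      have "h \<notin> fst ` N w \<or> k \<notin> fst ` N w"
        using indep that \<open>h \<in> W\<close> \<open>k \<in> W\<close> \<open>h \<noteq> k\<close> by blast
      then show ?thesis
      proof
        assume "h \<notin> fst ` N w"
        then show ?thesis by (simp add: discrete_deriv_def)
      next
        assume "k \<notin> fst ` N w"
        then have "falsified (N w) (insert h (insert k s)) = falsified (N w) (insert h (s - {k}))"
          "falsified (N w) (insert k s - {h}) = falsified (N w) (s - {k} - {h})"
          by (auto intro!: falsified_cong)
        then show ?thesis by (simp add: discrete_deriv_def)
      qed
    qed
    then show ?thesis unfolding h discrete_deriv_sum by simp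
  qed
  then obtain s where s: "s \<subseteq> H" "2 ^ card H * violations s
    \<le> (\<Sum>s\<in>Pow H. violations s) - (\<Sum>h\<in>W. (\<Sum>s\<in>Pow H. \<bar>discrete_deriv h violations s\<bar>) / 2)"
    using exists_le_mean_minus_derivs[OF finite_H finite_subset[OF assms(1) finite_H] assms(1)]
    by meson
  have "(\<Sum>h\<in>W. 2 ^ card H / 8) \<le> (\<Sum>h\<in>W. (\<Sum>s\<in>Pow H. \<bar>discrete_deriv h violations s\<bar>) / 2)"
    by (intro sum_mono) (use sum_abs_discrete_deriv_violations assms(2) in fastforce)
  with s(2) have "2 ^ card H * violations s \<le> 2 ^ card H * (card A / 8 - card W / 8)"
    by (simp add: sum_violations algebra_simps)
  then have "violations s \<le> card A / 8 - card W / 8"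
    by (simp only: mult_le_cancel_left_pos zero_less_power zero_less_numeral)
  with s(1) show ?thesis by blast
qed

section \<open>Structure of inert variables\<close>

text \<open>Inertness equates the numbers of clauses hinging on \<open>l\<close> and on its
  negation; so if one kind is present under \<open>s\<close>, so is the other.\<close>

lemma inert_cover:
  assumes "inert (fst l)" "w \<in> A" "l \<in> N w" "s \<subseteq> H" "falsified (N w - {l}) s"
  obtains w' where "w' \<in> A" "neg_literal l \<in> N w'" "falsified (N w' - {neg_literal l}) s"
proof -
  have "card (critical (fst l, False) s) = card (critical (fst l, True) s)"
    using assms(1,4) by (simp add: inert_def discrete_deriv_violations)
  moreover have "l = (fst l, snd l)" "neg_literal l = (fst l, \<not> snd l)"
    by (simp_all add: neg_literal_def)
  ultimately have "card (critical (neg_literal l) s) = card (critical l s)"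
    by (cases "snd l") simp_all
  moreover have "w \<in> critical l s" "finite (critical l s)"
    using assms finite_A by (auto simp: critical_def)
  ultimately have "critical (neg_literal l) s \<noteq> {}"
    by (auto simp: card_eq_0_iff)
  then show thesis using that by (auto simp: critical_def)
qed

text \<open>With \<open>h\<close> deleted, the two clauses containing \<open>h\<close> and the two
  containing its negation falsify on the same union of subcubes. Unless some clause of the first
  pair equals one of the second, the rigid shape of such covers clashes with the bound of two
  occurrences per literal or with complementary literals.\<close>

lemma inert_pair:
  assumes h: "inert h"
    and two: "card {w \<in> A. (h, True) \<in> N w} = 2" "card {w \<in> A. (h, False) \<in> N w} = 2"
  obtains x y a b where "x \<in> A" "y \<in> A" "N x = {(h, True), a, b}" "N y = {(h, False), a, b}"
    "fst a \<noteq> fst b" "fst a \<noteq> h" "fst b \<noteq> h"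
proof -
  obtain x1 x2 where x: "{w \<in> A. (h, True) \<in> N w} = {x1, x2}" "x1 \<noteq> x2"
    using two(1) by (auto simp: card_2_iff)
  obtain y1 y2 where y: "{w \<in> A. (h, False) \<in> N w} = {y1, y2}" "y1 \<noteq> y2"
    using two(2) by (auto simp: card_2_iff)
  have neg: "neg_literal (h, True) = (h, False)" "neg_literal (h, False) = (h, True)"
    by (simp_all add: neg_literal_def)
  have xA: "x1 \<in> A" "x2 \<in> A" "(h, True) \<in> N x1" "(h, True) \<in> N x2" using x by auto
  have yA: "y1 \<in> A" "y2 \<in> A" "(h, False) \<in> N y1" "(h, False) \<in> N y2" using y by auto
  have ne: "x1 \<noteq> y1" "x1 \<noteq> y2" "x2 \<noteq> y1" "x2 \<noteq> y2"
    using neg_notin_N[of _ "(h, True)"] xA yA neg by metis+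
  define P1 P2 where "P1 = N x1 - {(h, True)}" and "P2 = N x2 - {(h, True)}"
  define Q1 Q2 where "Q1 = N y1 - {(h, False)}" and "Q2 = N y2 - {(h, False)}"
  note defs = P1_def P2_def Q1_def Q2_def
  have card: "card P1 = 2" "card P2 = 2" "card Q1 = 2" "card Q2 = 2"
    using xA yA card_N by (auto simp: defs card_Diff_singleton_if)
  have inj: "inj_on fst P1" "inj_on fst P2" "inj_on fst Q1" "inj_on fst Q2"
    using xA yA inj_N by (auto simp: defs intro: inj_on_diff)
  have sub: "fst ` P1 \<subseteq> H" "fst ` P2 \<subseteq> H" "fst ` Q1 \<subseteq> H" "fst ` Q2 \<subseteq> H"
    using xA yA vars by (auto simp: defs)
  have coverP: "falsified Q1 s \<or> falsified Q2 s"
    if "s \<subseteq> H" "falsified P1 s \<or> falsified P2 s" for s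
    using that inert_cover[of "(h, True)" x1 s] inert_cover[of "(h, True)" x2 s] h xA y(1)
    unfolding defs neg fst_conv by (smt (verit) mem_Collect_eq insert_iff empty_iff)
  have coverQ: "falsified P1 s \<or> falsified P2 s"
    if "s \<subseteq> H" "falsified Q1 s \<or> falsified Q2 s" for s
    using that inert_cover[of "(h, False)" y1 s] inert_cover[of "(h, False)" y2 s] h yA x(1)
    unfolding defs neg fst_conv by (smt (verit) mem_Collect_eq insert_iff empty_iff)
  have mem: "l \<in> P1 \<Longrightarrow> l \<in> N x1" "l \<in> P2 \<Longrightarrow> l \<in> N x2"
    "l \<in> Q1 \<Longrightarrow> l \<in> N y1" "l \<in> Q2 \<Longrightarrow> l \<in> N y2" for l
    by (auto simp: defs)
  have "P1 = Q1 \<or> P1 = Q2 \<or> P2 = Q1 \<or> P2 = Q2"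
  proof (rule ccontr)
    assume no: "\<not> ?thesis"
    have "\<exists>z q r. Q1 = {z, q} \<and> Q2 = {neg_literal z, r} \<and> z \<notin> P1
      \<and> neg_literal z \<notin> P1 \<and> q \<in> P1 \<and> r \<in> P1"
      using falsified_cover_cases[of P1 Q1 Q2 H] card inj sub coverP no by blast
    then obtain z q r where 1: "Q1 = {z, q}" "Q2 = {neg_literal z, r}" "z \<notin> P1"
      "neg_literal z \<notin> P1" "q \<in> P1" "r \<in> P1" by blast
    \<comment> \<open>Otherwise \<open>q\<close> would occur in three clauses.\<close>
    have "q \<noteq> r"
      using occ_three[of q x1 y1 y2] mem[of q] 1 xA yA ne y(2) by auto
    have P1: "P1 = {q, r}"
      using card(1) 1(5,6) \<open>q \<noteq> r\<close> by (auto simp: card_2_iff)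
    have "\<exists>z' q' r'. P1 = {z', q'} \<and> P2 = {neg_literal z', r'} \<and> z' \<notin> Q1
      \<and> neg_literal z' \<notin> Q1 \<and> q' \<in> Q1 \<and> r' \<in> Q1"
      using falsified_cover_cases[of Q1 P1 P2 H] card inj sub coverQ no by blast
    then obtain z' q' r' where 2: "P1 = {z', q'}" "P2 = {neg_literal z', r'}" "z' \<notin> Q1"
      "r' \<in> Q1" by blast
    have "r' \<noteq> q"
      using occ_three[of q x1 x2 y1] mem[of q] 1 2 xA yA ne x(2) by auto
    \<comment> \<open>Here \<open>z'\<close> must be \<open>r\<close>, since \<open>q\<close> lies
      in \<open>Q1\<close>, and \<open>r'\<close> must be \<open>z\<close>.\<close>
    then have P2: "P2 = {neg_literal r, z}"
      using 1 2 P1 by auto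
    have "\<exists>z' q' r'. P1 = {z', q'} \<and> P2 = {neg_literal z', r'} \<and> z' \<notin> Q2
      \<and> neg_literal z' \<notin> Q2 \<and> q' \<in> Q2 \<and> r' \<in> Q2"
      using falsified_cover_cases[of Q2 P1 P2 H] card inj sub coverQ no by blast
    \<comment> \<open>This time \<open>z'\<close> avoids \<open>r\<close>, hence is
      \<open>q\<close>. Its negation in \<open>P2\<close> can only be \<open>z\<close>, although the
      negation of \<open>z\<close> is not in \<open>P1\<close>.\<close>
    then obtain z' q' r' where 3: "P1 = {z', q'}" "P2 = {neg_literal z', r'}" "z' \<notin> Q2" by blast
    then have "z' = q" using P1 1 by auto
    then have "neg_literal q = z" using P2 3 \<open>q \<noteq> r\<close> by (auto simp: doubleton_eq_iff)
    then show False using 1 by auto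
  qed
  then obtain x y where xy: "x \<in> A" "y \<in> A" "(h, True) \<in> N x" "(h, False) \<in> N y"
    "N x - {(h, True)} = N y - {(h, False)}"
    using xA yA unfolding defs by metis
  have "card (N x - {(h, True)}) = 2"
    using xy card_N by (simp add: card_Diff_singleton_if)
  then obtain a b where ab: "N x - {(h, True)} = {a, b}" "a \<noteq> b"
    by (auto simp: card_2_iff)
  have "N x = {(h, True), a, b}" "N y = {(h, False), a, b}"
    using ab xy by auto
  moreover have "a \<in> N x" "b \<in> N x" "a \<noteq> (h, True)" "b \<noteq> (h, True)"
    using ab(1) by auto
  then have "fst a \<noteq> fst b" "fst a \<noteq> h" "fst b \<noteq> h"
    using inj_onD[OF inj_N[OF xy(1)], of a b] inj_onD[OF inj_N[OF xy(1)], of a "(h, True)"]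
      inj_onD[OF inj_N[OF xy(1)], of b "(h, True)"] ab(2) xy(3) by auto
  ultimately show thesis using that xy by blast
qed

text \<open>The clauses \<open>x\<close> and \<open>y\<close> exhaust the occurrences of
  \<open>a\<close> and of \<open>b\<close>. Hence \<open>b\<close> controls every clause containing
  \<open>a\<close> but no clause containing the negation of \<open>a\<close>, and inertness
  fails.\<close>

lemma not_inert_if_paired:
  assumes "x \<in> A" "y \<in> A" "N x = {(h, True), a, b}" "N y = {(h, False), a, b}"
    "fst a \<noteq> fst b" "fst a \<noteq> h" "fst b \<noteq> h"
  shows "\<not> inert (fst a)"
proof
  assume inert: "inert (fst a)"
  have "x \<noteq> y"
    using assms(3-7) by auto
  have only: "w = x \<or> w = y" if "w \<in> A" "l \<in> N w" "l = a \<or> l = b" for w l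
    using occ_three[of l w x y] that assms(1-4) \<open>x \<noteq> y\<close> by auto
  show False
  proof (cases "\<exists>p\<in>A. neg_literal a \<in> N p")
    case True
    then obtain p where p: "p \<in> A" "neg_literal a \<in> N p" by blast
    have "a \<notin> N p"
      using neg_notin_N p by blast
    then have "b \<notin> N p"
      using only[of p b] p(1) assms(3,4) by auto
    \<comment> \<open>Falsifying \<open>?C\<close> makes \<open>b\<close> true and \<open>p\<close>
      hinge on the negation of \<open>a\<close>; but no clause containing \<open>a\<close> can then
      hinge on \<open>a\<close>.\<close>
    let ?C = "insert (neg_literal b) (N p - {neg_literal a})"
    have "l = neg_literal b" if "l \<in> N p" "fst l = fst b" for l
      using that \<open>b \<notin> N p\<close> fst_eq_literal_iff[of l b] by auto
    then have "inj_on fst ?C"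
      using inj_onD[OF inj_N[OF p(1)]]
      by (intro inj_onI) (metis insert_iff Diff_iff neg_literal_simps(1))
    moreover have "fst ` ?C \<subseteq> H"
      using vars[OF p(1)] vars[OF assms(1)] assms(3) by auto
    ultimately obtain s where s: "s \<subseteq> H" "falsified ?C s"
      using exists_falsifying by metis
    obtain w where w: "w \<in> A" "a \<in> N w" "falsified (N w - {a}) s"
      using inert_cover[of "neg_literal a" p s] inert p s by auto
    then have "b \<in> N w - {a}"
      using only[of w a] assms(3-5) by auto
    with w(3) s(2) show False
      by (auto simp: falsified_def)
  next
    case False
    \<comment> \<open>With \<open>b\<close> false, one of \<open>x\<close> and \<open>y\<close>
      hinges on \<open>a\<close> whatever the value of \<open>h\<close>, and no opposite clause
      compensates.\<close>
    have "fst ` {b} \<subseteq> H" "inj_on fst {b}" using vars[OF assms(1)] assms(3) by auto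
    then obtain s where s: "s \<subseteq> H" "falsified {b} s"
      using exists_falsifying by metis
    have "falsified (N x - {a}) s \<or> falsified (N y - {a}) s"
      using s(2) assms(3-7) by (auto simp: falsified_def)
    then show False
      using inert_cover[of a x s] inert_cover[of a y s] False inert assms(1-4) s(1) by auto
  qed
qed

section \<open>Counting occurrences and choosing the assignment\<close>

lemma card_var_occ:
  "card {w \<in> A. h \<in> fst ` N w}
    = card {w \<in> A. (h, True) \<in> N w} + card {w \<in> A. (h, False) \<in> N w}"
proof -
  have "{w \<in> A. h \<in> fst ` N w} = {w \<in> A. (h, True) \<in> N w} \<union> {w \<in> A. (h, False) \<in> N w}"
    using ex_bool_eq[of "\<lambda>b. (h, b) \<in> N w" for w] by force
  moreover have "{w \<in> A. (h, True) \<in> N w} \<inter> {w \<in> A. (h, False) \<in> N w} = {}"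
    using neg_notin_N[of _ "(h, True)"] by (auto simp: neg_literal_def)
  ultimately show ?thesis
    using finite_A by (simp add: card_Un_disjoint)
qed

lemma card_var_occ_le: "card {w \<in> A. h \<in> fst ` N w} \<le> 4"
  unfolding card_var_occ using occ_le[of "(h, True)"] occ_le[of "(h, False)"] by linarith

lemma card_vars: "w \<in> A \<Longrightarrow> card (fst ` N w) = 3"
  using card_N inj_N by (simp add: card_image)

lemma sum_card_var_occ: "(\<Sum>h\<in>H. card {w \<in> A. h \<in> fst ` N w}) = 3 * card A"
proof (intro sum_multicount finite_H finite_A ballI)
  fix w assume "w \<in> A"
  then have "{h \<in> H. h \<in> fst ` N w} = fst ` N w" using vars by auto
  then show "card {h \<in> H. h \<in> fst ` N w} = 3" using card_vars \<open>w \<in> A\<close> by simp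
qed

text \<open>Each inert variable occurring four times claims two literals of non-inert variables, and
  no literal is claimed twice. Non-inert variables offer two literals each.\<close>

lemma card_inert_le:
  "card {h \<in> H. inert h \<and> card {w \<in> A. h \<in> fst ` N w} = 4} \<le> card {h \<in> H. \<not> inert h}"
proof -
  define B where "B = {h \<in> H. inert h \<and> card {w \<in> A. h \<in> fst ` N w} = 4}"
  define G where "G = {h \<in> H. \<not> inert h}"
  define paired where "paired h a b \<longleftrightarrow> (\<exists>x\<in>A. \<exists>y\<in>A. N x = {(h, True), a, b}
    \<and> N y = {(h, False), a, b} \<and> fst a \<noteq> fst b \<and> fst a \<noteq> h \<and> fst b \<noteq> h)" for h a b
  have swap: "paired h a b \<Longrightarrow> paired h b a" for h a b
    unfolding paired_def by (metis insert_commute)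
  have "\<exists>a b. paired h a b" if "h \<in> B" for h
  proof -
    have two: "card {w \<in> A. (h, True) \<in> N w} = 2" "card {w \<in> A. (h, False) \<in> N w} = 2"
      using that[unfolded B_def] card_var_occ[of h] occ_le[of "(h, True)"] occ_le[of "(h, False)"]
      by auto
    have "inert h" using that by (simp add: B_def)
    from inert_pair[OF this two] show ?thesis
      unfolding paired_def by metis
  qed
  then have "\<exists>a b. \<forall>h\<in>B. paired h (a h) (b h)"
    by metis
  then obtain a b where ab: "paired h (a h) (b h)" if "h \<in> B" for h
    by blast
  define Z where "Z h = {a h, b h}" for h
  have pairedD: "\<exists>x\<in>A. \<exists>y\<in>A. c \<in> N x \<and> c \<in> N y \<and> N x - N y = {(h, True)}
    \<and> N y - N x = {(h, False)} \<and> \<not> inert (fst c)" if paired: "paired h c d" for h c d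
  proof -
    obtain x y where xy: "x \<in> A" "y \<in> A" "N x = {(h, True), c, d}" "N y = {(h, False), c, d}"
      "fst c \<noteq> fst d" "fst c \<noteq> h" "fst d \<noteq> h" using paired unfolding paired_def by blast
    have "(h, b) \<noteq> c" "(h, b) \<noteq> d" for b using xy(6,7) by auto
    then have "N x - N y = {(h, True)}" "N y - N x = {(h, False)}"
      unfolding xy(3,4) by (simp_all add: insert_Diff_if)
    moreover have "c \<in> N x" "c \<in> N y" unfolding xy(3,4) by simp_all
    ultimately show ?thesis using not_inert_if_paired[OF xy] xy(1,2) by blast
  qed
  have eq: "h = h'" if p: "paired h c d" and p': "paired h' c d'" for h h' c d d'
  proof -
    obtain x y where xy: "x \<in> A" "y \<in> A" "c \<in> N x" "c \<in> N y"
      "N x - N y = {(h, True)}" "N y - N x = {(h, False)}"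
      using pairedD[OF p] by blast
    obtain x' y' where xy': "x' \<in> A" "y' \<in> A" "c \<in> N x'" "c \<in> N y'"
      "N x' - N y' = {(h', True)}" "N y' - N x' = {(h', False)}"
      using pairedD[OF p'] by blast
    \<comment> \<open>As \<open>c\<close> occurs at most twice, both pairs consist of the same two
      clauses, whose difference reveals the variable.\<close>
    have "x \<noteq> y" using xy(5) by auto
    then have "x' = x \<or> x' = y" "y' = x \<or> y' = y"
      using occ_three[of c x y x'] occ_three[of c x y y'] xy(1-4) xy'(1-4) by auto
    then have "{(h', True)} \<in> {{}, {(h, True)}, {(h, False)}}"
      unfolding xy(5)[symmetric] xy(6)[symmetric] xy'(5)[symmetric] by (elim disjE) simp_all
    then show "h = h'" by simp
  qed
  have inG: "Z h \<subseteq> G \<times> UNIV" if "h \<in> B" for h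
  proof -
    have "c \<in> G \<times> UNIV" if "paired h c d" for c d
    proof -
      have "fst c \<in> H" "\<not> inert (fst c)" using pairedD[OF that] vars by auto
      then show ?thesis by (simp add: G_def mem_Times_iff)
    qed
    then show ?thesis using ab[OF that] swap[OF ab[OF that]] by (simp add: Z_def)
  qed
  have card_Z: "card (Z h) = 2" if "h \<in> B" for h
  proof -
    have "a h \<noteq> b h" using ab[OF that] unfolding paired_def by metis
    then show ?thesis by (simp add: Z_def)
  qed
  have disj: "Z h \<inter> Z h' = {}" if "h \<in> B" "h' \<in> B" "h \<noteq> h'" for h h'
  proof -
    have "h = h'" if "c \<in> Z h" "c \<in> Z h'" for c
    proof -
      have "\<exists>d. paired h c d" "\<exists>d. paired h' c d"
        using that ab[OF \<open>h \<in> B\<close>] ab[OF \<open>h' \<in> B\<close>] swap unfolding Z_def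
        by (metis insert_iff empty_iff)+
      then show ?thesis using eq by blast
    qed
    with \<open>h \<noteq> h'\<close> show ?thesis by blast
  qed
  have "2 * card B = (\<Sum>h\<in>B. card (Z h))"
    using card_Z by simp
  also have "\<dots> = card (\<Union>h\<in>B. Z h)"
    using disj finite_H by (intro card_UN_disjoint[symmetric]) (auto simp: Z_def B_def)
  also have "\<dots> \<le> card (G \<times> (UNIV :: bool set))"
    using inG finite_H by (intro card_mono UN_least) (auto simp: G_def)
  also have "\<dots> = 2 * card G"
    by (simp add: card_cartesian_product)
  finally show ?thesis by (simp add: B_def G_def)
qed

lemma exists_assignment: "\<exists>s\<subseteq>H. violations s \<le> (1 / 6 - 1 / 204) * card H"
proof -
  let ?t = "\<lambda>h. card {w \<in> A. h \<in> fst ` N w}"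
  define L where "L = {h \<in> H. ?t h \<noteq> 4}"
  define G where "G = {h \<in> H. \<not> inert h}"
  define R where "R h k \<longleftrightarrow> (\<exists>w\<in>A. h \<in> fst ` N w \<and> k \<in> fst ` N w)" for h k
  have fin: "finite L" "finite G" using finite_H by (simp_all add: L_def G_def)
  \<comment> \<open>At most four clauses contain \<open>h\<close>, each with two other
    variables.\<close>
  have deg: "card {k \<in> G. k \<noteq> h \<and> R h k} \<le> 8" for h
  proof -
    let ?W = "{w \<in> A. h \<in> fst ` N w}"
    have "card {k \<in> G. k \<noteq> h \<and> R h k} \<le> card (\<Union>w\<in>?W. fst ` N w - {h})"
      using finite_A finite_N by (intro card_mono) (auto simp: R_def)
    also have "\<dots> \<le> (\<Sum>w\<in>?W. card (fst ` N w - {h}))"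
      using finite_A by (intro card_UN_le) simp
    also have "\<dots> = (\<Sum>w\<in>?W. 2)"
      using card_vars by (intro sum.cong) (auto simp: card_Diff_singleton_if)
    also have "\<dots> \<le> 8" using card_var_occ_le[of h] by simp
    finally show ?thesis .
  qed
  obtain W where W: "W \<subseteq> G" "\<And>h k. h \<in> W \<Longrightarrow> k \<in> W \<Longrightarrow> h \<noteq> k \<Longrightarrow> \<not> R h k"
    "card G \<le> 9 * card W"
    using exists_large_independent_subset[of G R 8] fin deg unfolding R_def by auto
  have "\<exists>s\<subseteq>H. violations s \<le> card A / 8 - card W / 8"
  proof (rule exists_assignment_saving)
    show "W \<subseteq> H" using W(1) by (auto simp: G_def)
    show "\<not> inert h" if "h \<in> W" for h using that W(1) by (auto simp: G_def)
    show False if "w \<in> A" "h \<in> W" "k \<in> W" "h \<noteq> k" "h \<in> fst ` N w" "k \<in> fst ` N w" for w h k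
      using that W(2)[of h k] unfolding R_def by blast
  qed
  then obtain s where s: "s \<subseteq> H" "violations s \<le> card A / 8 - card W / 8" by blast
  have "H \<subseteq> L \<union> G \<union> {h \<in> H. inert h \<and> ?t h = 4}" by (auto simp: L_def G_def)
  then have "card H \<le> card (L \<union> G \<union> {h \<in> H. inert h \<and> ?t h = 4})"
    using fin finite_H by (intro card_mono) auto
  also have "\<dots> \<le> card L + card G + card {h \<in> H. inert h \<and> ?t h = 4}"
    using card_Un_le[of L G] card_Un_le[of "L \<union> G"] by (meson add_le_mono le_refl le_trans)
  also have "\<dots> \<le> card L + 2 * card G"
    using card_inert_le by (simp add: G_def)
  finally have H: "card H \<le> card L + 2 * card G" .
  \<comment> \<open>Variables in \<open>L\<close> occur at most three times, all others at most four
    times.\<close>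
  have "(\<Sum>h\<in>H. ?t h + of_bool (h \<in> L)) \<le> (\<Sum>h\<in>H. 4)"
    using card_var_occ_le by (intro sum_mono) (auto simp: L_def le_neq_implies_less Suc_le_eq)
  then have "3 * card A + card L \<le> 4 * card H"
    using finite_H by (simp add: sum.distrib sum_card_var_occ) (simp add: L_def Int_def conj_commute)
  then have "3 * real (card A) + card L \<le> 4 * card H" "real (card H) \<le> card L + 2 * card G"
    "real (card G) \<le> 9 * card W"
    using H W(3) by linarith+
  \<comment> \<open>The mean is at most \<open>card H / 6 - card L / 24\<close> and the saving at
    least \<open>card G / 72\<close>. Since \<open>card L / 24 + card G / 72\<close> is at least
    \<open>(card L + 2 * card G) / 144\<close>, the total gain is at least
    \<open>card H / 144\<close>, more than required.\<close>
  then have "real (card A) / 8 - card W / 8 \<le> (1 / 6 - 1 / 204) * card H"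
    by (simp add: field_simps)
  with s show ?thesis by (meson order_trans)
qed

end

subsection \<open>Cubic graphs\<close>

context cubic_graph
begin

lemma edge_cases:
  assumes "e \<in> E" "v \<in> e"
  obtains u where "e = {u, v}" "u \<noteq> v" "u \<in> neighbors E v"
proof -
  have "card e = 2" using edges assms by blast
  then obtain x y where "e = {x, y}" "x \<noteq> y" by (auto simp: card_2_iff)
  then show thesis
    using that[of x] that[of y] assms unfolding neighbors_def by (auto simp: insert_commute)
qed

lemma neighbors_verts: "u \<in> neighbors E v \<Longrightarrow> u \<in> V \<and> v \<in> V \<and> u \<noteq> v \<and> v \<in> neighbors E u"
  using edges[of "{u, v}"] by (auto simp: neighbors_def insert_commute)

text \<open>An edge with both ends uncovered could be added to the matching.\<close>

lemma uncovered_independent: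
  assumes "maximal_matching E M" "{u, v} \<in> E"
  shows "u \<in> \<Union>M \<or> v \<in> \<Union>M"
proof (rule ccontr)
  assume no: "\<not> ?thesis"
  then have "graph_matching E (insert {u, v} M)"
    using assms unfolding maximal_matching_def graph_matching_def by auto
  then have "{u, v} \<in> M"
    using assms(1) unfolding maximal_matching_def by blast
  with no show False by auto
qed

lemma exists_dominating_set:
  assumes M: "maximal_matching E M"
  shows "\<exists>D. dominating_set V E D \<and> real (card D) \<le> (7 / 6 - 1 / 204) * card M"
proof -
  have ME: "M \<subseteq> E" and disj: "\<And>e f. e \<in> M \<Longrightarrow> f \<in> M \<Longrightarrow> e \<noteq> f \<Longrightarrow> e \<inter> f = {}"
    using M unfolding maximal_matching_def graph_matching_def by auto
  have finM: "finite M" using ME finite_edges finite_subset by blast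
  have UV: "\<Union>M \<subseteq> V" using ME edges by blast
  define edge where "edge v = (THE e. e \<in> M \<and> v \<in> e)" for v
  have edge: "edge v = e" if "e \<in> M" "v \<in> e" for v e
    unfolding edge_def using that disj by (intro the_equality) auto
  \<comment> \<open>The variable is the matching edge at \<open>v\<close>; the sign tells whether
    \<open>v\<close> is its arbitrarily chosen positive end, so the two ends of an edge get
    complementary literals.\<close>
  define lit where "lit v = (edge v, v = (SOME u. u \<in> edge v))" for v
  have lit_partner: "lit v = neg_literal (lit u) \<and> u \<in> \<Union>M \<and> v \<in> \<Union>M"
    if "{u, v} \<in> M" "u \<noteq> v" for u v
  proof -
    have "(SOME w. w \<in> {u, v}) \<in> {u, v}" by (rule someI[of _ u]) simp
    moreover have "edge u = {u, v}" "edge v = {u, v}" using that edge by auto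
    ultimately show ?thesis using that by (auto simp: lit_def neg_literal_def)
  qed
  have partner: "\<exists>u. {u, v} \<in> M \<and> u \<noteq> v \<and> u \<in> neighbors E v" if "v \<in> \<Union>M" for v
    using that ME edge_cases by (metis UnionE subsetD)
  have lit_inj: "u = v" if uU: "u \<in> \<Union>M" and vU: "v \<in> \<Union>M" and eq: "lit u = lit v" for u v
  proof (rule ccontr)
    assume "u \<noteq> v"
    obtain u' where u': "{u', u} \<in> M" "u' \<noteq> u" using partner[OF uU] by blast
    have "edge u = {u', u}" using u' edge by auto
    moreover have "v \<in> edge v" using vU edge by auto
    ultimately have "v = u'" using eq \<open>u \<noteq> v\<close> by (auto simp: lit_def)
    then show False using lit_partner[OF u'] eq by auto
  qed
  \<comment> \<open>Only vertices with neighbours on three different matching edges give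
    clauses.\<close>
  define A where "A = {w \<in> V - \<Union>M. inj_on (fst \<circ> lit) (neighbors E w)}"
  define N where "N w = lit ` neighbors E w" for w
  have nbrs: "neighbors E w \<subseteq> \<Union>M" if "w \<in> V - \<Union>M" for w
    using that uncovered_independent[OF M] unfolding neighbors_def by blast
  have "clauses M A N"
  proof
    show "finite M" by (rule finM)
    show "finite A" using finite_verts by (simp add: A_def)
    fix w assume w: "w \<in> A"
    then have inj: "inj_on (fst \<circ> lit) (neighbors E w)" and U: "neighbors E w \<subseteq> \<Union>M"
      using nbrs by (auto simp: A_def)
    show "fst ` N w \<subseteq> M"
      using U edge by (auto simp: N_def lit_def)
    show "card (N w) = 3"
      using inj_on_imageI2[OF inj] cubic w by (simp add: N_def A_def card_image)
    show "inj_on fst (N w)"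
      unfolding N_def by (rule inj_on_imageI[OF inj])
  next
    fix l
    show "card {w \<in> A. l \<in> N w} \<le> 2"
    proof (cases "\<exists>v\<in>\<Union>M. lit v = l")
      case True
      then obtain v where v: "v \<in> \<Union>M" "lit v = l" by blast
      obtain u where u: "{u, v} \<in> M" "u \<in> neighbors E v" using partner[OF v(1)] by blast
      \<comment> \<open>The partner of \<open>v\<close> is covered and so not in \<open>A\<close>,
        which leaves at most two of the three neighbours.\<close>
      have "{w \<in> A. l \<in> N w} \<subseteq> neighbors E v - {u}"
      proof
        fix w assume "w \<in> {w \<in> A. l \<in> N w}"
        then obtain v' where w: "w \<in> V - \<Union>M" "v' \<in> neighbors E w" "lit v' = l"
          by (auto simp: A_def N_def)
        then have "v' = v" using lit_inj v nbrs by blast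
        then show "w \<in> neighbors E v - {u}" using w u(1) neighbors_verts by blast
      qed
      moreover have card: "card (neighbors E v) = 3" using cubic v UV by blast
      moreover have "finite (neighbors E v)" using card card.infinite by fastforce
      ultimately show ?thesis
        using u(2) card_mono[of "neighbors E v - {u}" "{w \<in> A. l \<in> N w}"] by simp
    next
      case False
      then have "{w \<in> A. l \<in> N w} = {}" using nbrs unfolding A_def N_def by blast
      then show ?thesis by (simp only: card.empty)
    qed
  qed
  then interpret clauses M A N .
  obtain s where s: "violations s \<le> (1 / 6 - 1 / 204) * card M"
    using exists_assignment by blast
  define sat where "sat v \<longleftrightarrow> (fst (lit v) \<in> s) = snd (lit v)" for v
  \<comment> \<open>The true literals select one end of each matching edge; \<open>F\<close> adds
    the uncovered vertices that have no selected neighbour.\<close>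
  define T where "T = {v \<in> \<Union>M. sat v}"
  define F where "F = {w \<in> A. falsified (N w) s}"
  have sat_opp: "sat u \<longleftrightarrow> \<not> sat v"
    if "u \<in> \<Union>M" "v \<in> \<Union>M" "edge u = edge v" "u \<noteq> v" for u v
  proof -
    have "fst (lit u) = fst (lit v)" using that(3) by (simp add: lit_def)
    moreover have "snd (lit u) \<noteq> snd (lit v)"
      using lit_inj that calculation prod_eqI[of "lit u" "lit v"] by blast
    ultimately show ?thesis unfolding sat_def by auto
  qed
  have "inj_on edge T"
  proof (rule inj_onI)
    fix u v assume "u \<in> T" "v \<in> T" "edge u = edge v"
    then show "u = v" using sat_opp[of u v] unfolding T_def by blast
  qed
  moreover have "edge ` T \<subseteq> M" using edge by (auto simp: T_def)
  ultimately have "card T \<le> card M" using finM card_inj_on_le by blast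
  moreover have "violations s = card F"
    using finite_A by (simp add: violations_def F_def Int_def)
  moreover have "card (T \<union> F) \<le> card T + card F" by (rule card_Un_le)
  ultimately have "card (T \<union> F) \<le> (7 / 6 - 1 / 204) * real (card M)"
    using s by simp
  moreover have "dominating_set V E (T \<union> F)"
    unfolding dominating_set_def
  proof (intro conjI ballI)
    show "T \<union> F \<subseteq> V" using UV by (auto simp: T_def F_def A_def)
    fix v assume v: "v \<in> V - (T \<union> F)"
    have "\<exists>u\<in>neighbors E v. u \<in> T"
    proof (cases "v \<in> \<Union>M")
      case True
      then obtain u where u: "{u, v} \<in> M" "u \<noteq> v" "u \<in> neighbors E v" using partner by blast
      then have "edge u = edge v" "u \<in> \<Union>M" using edge by auto
      with u True v sat_opp[of u v] show ?thesis by (auto simp: T_def)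
    next
      case False
      then have U: "neighbors E v \<subseteq> \<Union>M" using v nbrs by blast
      show ?thesis
      proof (cases "v \<in> A")
        case True
        then have "\<not> falsified (N v) s" using v by (simp add: F_def)
        then obtain u where "u \<in> neighbors E v" "sat u"
          by (auto simp: falsified_def N_def sat_def)
        with U show ?thesis unfolding T_def by blast
      next
        \<comment> \<open>Two neighbours of \<open>v\<close> are the two ends of one matching edge,
          and one of them is selected under any assignment.\<close>
        case outside: False
        then obtain x y where xy: "x \<in> neighbors E v" "y \<in> neighbors E v" "x \<noteq> y"
          "edge x = edge y"
          using v False by (auto simp: A_def inj_on_def lit_def)
        with U sat_opp[of x y] show ?thesis unfolding T_def by blast
      qed
    qed
    then show "neighbors E v \<inter> (T \<union> F) \<noteq> {}" by blast
  qed
  ultimately show ?thesis by blast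
qed

end

theorem theorem2:
  fixes V :: "'a set" and E :: "'a set set"
  assumes "cubic_graph V E"
  shows "real (domination_number V E)
    \<le> (7 / 6 - 1 / 204) * real (edge_domination_number E)"
proof -
  interpret cubic_graph V E by (rule assms)
  have "edge_domination_number E \<in> card ` {M. maximal_matching E M}"
    unfolding edge_domination_number_def
    using finite_maximal_matchings maximal_matchings_nonempty by (intro Min_in) auto
  then obtain M where M: "maximal_matching E M" "card M = edge_domination_number E" by auto
  obtain D where D: "dominating_set V E D" "real (card D) \<le> (7 / 6 - 1 / 204) * card M"
    using exists_dominating_set[OF M(1)] by blast
  have "domination_number V E \<le> card D"
    unfolding domination_number_def using D(1) finite_dominating_sets by (intro Min_le) auto
  with D(2) M(2) show ?thesis by simp
qed

end
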